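(* Let $X_i\subseteq\mathbb{R}^n$ be a convex and closed set and $f_i:\mathbb{R}^n\to\mathbb{R}$ a convex function for $i=1,\dots,m$. Let $N=mn$, $X=X_1\times\dots\times X_m\subseteq\mathbb{R}^N$, let $f(x)=\sum_{i=1}^m f_i(x_i)$ for $x=(x_1,\dots,x_m)\in\mathbb{R}^N$, and let $$p(x)=\frac{1}{2\tau}\left(\sum_{i=1}^{m-1}\|x_i-x_{i+1}\|^2+\|x_m-x_1\|^2\right).$$ Suppose that the set $X^*(p)$ of minimizers of $p$ over $X$ is nonempty, and that $f$ is coercive on $X$. Let $\beta\in(0,1)$, $\tau\ge 1$, and $\alpha\in(0,\alpha']$ with $\alpha'=1/(\beta+2/\tau)$. Let $\{e^s\}$, $e^s=(\varepsilon^s_1,\dots,\varepsilon^s_m)^\top$, be a sequence of vectors with positive components and $\{\theta_s\}$ a sequence of positive numbers such that $$\varepsilon^s_i\searrow 0\ \text{ as } s\to\infty,\quad i=1,\dots,m,\qquad \lim_{s\to\infty}\frac{\varepsilon^s_i}{\varepsilon^s_j}=1\quad\text{for all } i\neq j,$$ $$\lim_{s\to\infty}\frac{\theta_s}{\varepsilon^s_j}=0\quad\text{for all } j=1,\dots,m.$$ Consider Method (DPM) (described in the context) applied with these data from an arbitrary starting point $u^0\in X$. Then: (i) The number of iterations at each stage of Method (DPM) is finite. (ii) Each sequence $\{u^s\}$ generated by Method (DPM) has limit points, and all these limit points are solutions of the problem $$\min_{x\in X^*(p)} f(x).$$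
   Context: Vectors $x\in\mathbb{R}^N$, $N=mn$, are written in blocks $x=(x_1,\dots,x_m)$ with $x_i\in\mathbb{R}^n$; $\|\cdot\|$ is the Euclidean norm and $p'$ is the gradient of $p$. A function $f$ is coercive on $X$ if $f(x)\to+\infty$ as $\|x\|\to\infty$, $x\in X$. $X^*(p)=\{x\in X: p(x)=\inf_{y\in X}p(y)\}$. The notation $\varepsilon^s_i\searrow 0$ means that the sequence $\{\varepsilon^s_i\}_s$ of positive numbers is nonincreasing and converges to $0$. A limit point of a sequence is the limit of some convergent subsequence. For a vector $e=(\varepsilon_1,\dots,\varepsilon_m)^\top$ with positive components and $x\in X$, let $y_{\alpha,e}(x)$ denote the unique solution of the strongly convex problem $$\min_{z\in X}\left\{\sum_{i=1}^m\varepsilon_i f_i(z_i)+\langle p'(x),z\rangle+\frac{1}{2\alpha}\|z-x\|^2\right\}.$$ Method (DPM): start from $u^0\in X$. At the $s$-th stage, $s=1,2,\dots$, given $u^{s-1}\in X$, $e^s$ and $\theta_s$, set $x^0=u^{s-1}$ and iterate $x^{k+1}=y_{\alpha,e^s}(x^k)$, $k=0,1,2,\dots$, until a point $x^{k+1}$ is obtained such that $\|x^{k+1}-x^k\|\le\theta_s$; then set $u^s=x^{k+1}$ and go to the next stage. *)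

theory Defs
  imports "HOL-Analysis.Analysis"
begin

text \<open>
  A point of \<open>\<real>\<^sup>N\<close>, \<open>N = m n\<close>, is an element of \<^typ>\<open>(real^'n)^'m\<close> with
  \<open>m = CARD('m)\<close>, \<open>n = CARD('n)\<close>; the library norm and inner product of this type are the
  Euclidean ones. Only the function \<open>p\<close> depends on the order of the blocks; there the blocks are
  enumerated by a bijection from \<open>{1..m}\<close> to \<^typ>\<open>'m\<close>.
\<close>

definition block_product :: "('m::finite \<Rightarrow> (real^'n::finite) set) \<Rightarrow> (real^'n^'m) set" where
  "block_product Xs = {x. \<forall>i. x $ i \<in> Xs i}"

definition block_sum :: "('m::finite \<Rightarrow> real^'n::finite \<Rightarrow> real) \<Rightarrow> real^'n^'m \<Rightarrow> real" where
  "block_sum fs x = (\<Sum>i\<in>UNIV. fs i (x $ i))"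

definition ring_penalty :: "(nat \<Rightarrow> 'm::finite) \<Rightarrow> real \<Rightarrow> real^'n::finite^'m \<Rightarrow> real" where
  "ring_penalty idx \<tau> x =
     1 / (2 * \<tau>) *
       ((\<Sum>i = 1..CARD('m) - 1. (norm (x $ idx i - x $ idx (i + 1)))\<^sup>2)
        + (norm (x $ idx CARD('m) - x $ idx 1))\<^sup>2)"

text \<open>If \<open>X\<close> is bounded, the filter below is trivial and every function is coercive on \<open>X\<close>.\<close>

definition coercive_on :: "'a::real_normed_vector set \<Rightarrow> ('a \<Rightarrow> real) \<Rightarrow> bool" where
  "coercive_on X f \<longleftrightarrow> filterlim f at_top (inf at_infinity (principal X))"

definition minimizers :: "'a set \<Rightarrow> ('a \<Rightarrow> real) \<Rightarrow> 'a set" where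
  "minimizers X p = {x \<in> X. p x = (INF y\<in>X. p y)}"

definition limit_point_of_seq :: "(nat \<Rightarrow> 'a::topological_space) \<Rightarrow> 'a \<Rightarrow> bool" where
  "limit_point_of_seq u l \<longleftrightarrow> (\<exists>r. strict_mono r \<and> (u \<circ> r) \<longlonglongrightarrow> l)"

definition gradient :: "('a::real_inner \<Rightarrow> real) \<Rightarrow> 'a \<Rightarrow> 'a" where
  "gradient p x = (THE g. GDERIV p x :> g)"

definition prox_step ::
  "(real^'n::finite^'m::finite) set \<Rightarrow> ('m \<Rightarrow> real^'n \<Rightarrow> real) \<Rightarrow> (real^'n^'m \<Rightarrow> real) \<Rightarrow> real
    \<Rightarrow> real^'m \<Rightarrow> real^'n^'m \<Rightarrow> real^'n^'m" where
  "prox_step X fs p \<alpha> \<epsilon> x =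
     (THE z. is_arg_min
        (\<lambda>z. (\<Sum>i\<in>UNIV. \<epsilon> $ i * fs i (z $ i)) + gradient p x \<bullet> z
              + 1 / (2 * \<alpha>) * (norm (z - x))\<^sup>2)
        (\<lambda>z. z \<in> X) z)"

definition inner_iterate ::
  "(real^'n::finite^'m::finite) set \<Rightarrow> ('m \<Rightarrow> real^'n \<Rightarrow> real) \<Rightarrow> (real^'n^'m \<Rightarrow> real) \<Rightarrow> real
    \<Rightarrow> real^'m \<Rightarrow> real^'n^'m \<Rightarrow> nat \<Rightarrow> real^'n^'m" where
  "inner_iterate X fs p \<alpha> \<epsilon> x0 k = (prox_step X fs p \<alpha> \<epsilon> ^^ k) x0"

definition stage_stops_at ::
  "(real^'n::finite^'m::finite) set \<Rightarrow> ('m \<Rightarrow> real^'n \<Rightarrow> real) \<Rightarrow> (real^'n^'m \<Rightarrow> real) \<Rightarrow> real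
    \<Rightarrow> real^'m \<Rightarrow> real \<Rightarrow> real^'n^'m \<Rightarrow> nat \<Rightarrow> bool" where
  "stage_stops_at X fs p \<alpha> \<epsilon> \<theta> x0 k \<longleftrightarrow>
     norm (inner_iterate X fs p \<alpha> \<epsilon> x0 (k + 1) - inner_iterate X fs p \<alpha> \<epsilon> x0 k) \<le> \<theta>"

text \<open>A stage started at \<open>x0\<close> stops at the first \<open>k\<close> that passes the test, with result \<open>v\<close>.\<close>

definition stage_result ::
  "(real^'n::finite^'m::finite) set \<Rightarrow> ('m \<Rightarrow> real^'n \<Rightarrow> real) \<Rightarrow> (real^'n^'m \<Rightarrow> real) \<Rightarrow> real
    \<Rightarrow> real^'m \<Rightarrow> real \<Rightarrow> real^'n^'m \<Rightarrow> real^'n^'m \<Rightarrow> bool" where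
  "stage_result X fs p \<alpha> \<epsilon> \<theta> x0 v \<longleftrightarrow>
     (\<exists>k. stage_stops_at X fs p \<alpha> \<epsilon> \<theta> x0 k \<and> (\<forall>j<k. \<not> stage_stops_at X fs p \<alpha> \<epsilon> \<theta> x0 j)
        \<and> v = inner_iterate X fs p \<alpha> \<epsilon> x0 (k + 1))"

text \<open>
  \<open>dpm_run_upto \<dots> S u\<close> says that \<open>u 1, \<dots>, u S\<close> are the results of the first \<open>S\<close> stages. Keeping
  partial runs separate from infinite ones allows one to speak of stage \<open>s\<close> without presupposing
  that it, or any later stage, terminates. The data of stage \<open>s \<ge> 1\<close> are \<open>e s\<close> and \<open>\<theta> s\<close>; the
  values \<open>e 0\<close> and \<open>\<theta> 0\<close> are never used.
\<close>

definition dpm_run_upto ::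
  "(real^'n::finite^'m::finite) set \<Rightarrow> ('m \<Rightarrow> real^'n \<Rightarrow> real) \<Rightarrow> (real^'n^'m \<Rightarrow> real) \<Rightarrow> real
    \<Rightarrow> (nat \<Rightarrow> real^'m) \<Rightarrow> (nat \<Rightarrow> real) \<Rightarrow> real^'n^'m \<Rightarrow> nat \<Rightarrow> (nat \<Rightarrow> real^'n^'m) \<Rightarrow> bool" where
  "dpm_run_upto X fs p \<alpha> e \<theta> u0 S u \<longleftrightarrow>
     u 0 = u0 \<and> (\<forall>s\<in>{1..S}. stage_result X fs p \<alpha> (e s) (\<theta> s) (u (s - 1)) (u s))"

definition dpm_run ::
  "(real^'n::finite^'m::finite) set \<Rightarrow> ('m \<Rightarrow> real^'n \<Rightarrow> real) \<Rightarrow> (real^'n^'m \<Rightarrow> real) \<Rightarrow> real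
    \<Rightarrow> (nat \<Rightarrow> real^'m) \<Rightarrow> (nat \<Rightarrow> real) \<Rightarrow> real^'n^'m \<Rightarrow> (nat \<Rightarrow> real^'n^'m) \<Rightarrow> bool" where
  "dpm_run X fs p \<alpha> e \<theta> u0 u \<longleftrightarrow> (\<forall>S. dpm_run_upto X fs p \<alpha> e \<theta> u0 S u)"

end

theory Submission
  imports Defs
begin

text \<open>
  Everything rests on one inequality. Let \<open>z\<close> be the proximal step from \<open>x\<close> for weights \<open>\<epsilon>\<close>, and write
  \<open>g = \<Sum>i. \<epsilon>\<^sub>i f\<^sub>i\<close>. Two facts combine. Optimality of \<open>z\<close> in a strongly convex problem gives a variational
  inequality, \<open>prox_variational_inequality\<close>. The penalty \<open>p\<close> is a quadratic form, so that
  \<open>p (x + d) = p x + \<langle>p' x, d\<rangle> + p d\<close> exactly, with \<open>0 \<le> p d \<le> (2 / \<tau>) \<parallel>d\<parallel>\<^sup>2\<close>; this is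
  \<open>ring_penalty_expand\<close> and \<open>ring_penalty_le\<close>. Replacing the linearized penalty by the penalty itself
  yields, for every \<open>w\<close> in \<open>X\<close> (lemma \<open>step_estimate\<close>),
  \<open>g z + p z \<le> g w + p w + (2 / \<tau>) \<parallel>z - x\<parallel>\<^sup>2 + \<langle>z - x, w - z\<rangle> / \<alpha>\<close>.

  For \<open>w = x\<close> this is a descent estimate: \<open>g + p\<close> drops by at least \<open>\<beta> \<parallel>z - x\<parallel>\<^sup>2\<close>, because
  \<open>1 / \<alpha> \<ge> \<beta> + 2 / \<tau>\<close>. As \<open>g + p\<close> is bounded below on \<open>X\<close>, only finitely many steps can be longer than
  \<open>\<theta>\<close>, so every stage ends (\<open>stage_terminates\<close>).

  When a stage ends, \<open>\<parallel>z - x\<parallel> \<le> \<theta>\<close>, and the same inequality says that the result \<open>u\<close> of the stage is nearly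
  optimal for \<open>g + p\<close> (\<open>stage_result_near_optimal\<close>). Take for \<open>w\<close> a minimizer of \<open>p\<close> and divide by
  one of the weights. The quotients of weights tend to 1 and \<open>\<theta>\<close> divided by a weight tends to 0, so
  asymptotically \<open>f u \<le> f w + o(1) (1 + \<parallel>u\<parallel>)\<close>. A convex coercive function grows at least linearly
  (\<open>coercive_convex_linear_growth\<close>), so the error term is absorbed and the sequence is bounded
  (\<open>bounded_u\<close>). At a limit point, the undivided inequality shows that \<open>p\<close> is minimal, since the weights
  vanish (\<open>limit_minimizes_penalty\<close>), and the divided one shows that \<open>f\<close> is minimal among the minimizers
  of \<open>p\<close> (\<open>limit_minimizes_sum\<close>).
\<close>

section \<open>Proximal minimization of a linearly perturbed convex function\<close>

lemma prox_objective_diff: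
  fixes z w x g :: "'a::real_inner"
  shows "(h w + g \<bullet> w + 1 / (2 * \<alpha>) * (norm (w - x))\<^sup>2) - (h z + g \<bullet> z + 1 / (2 * \<alpha>) * (norm (z - x))\<^sup>2)
    = h w - h z + g \<bullet> (w - z) + (z - x) \<bullet> (w - z) / \<alpha> + 1 / (2 * \<alpha>) * (norm (w - z))\<^sup>2"
proof -
  have "(norm (w - x))\<^sup>2 = (norm (z - x))\<^sup>2 + 2 * ((z - x) \<bullet> (w - z)) + (norm (w - z))\<^sup>2"
    unfolding power2_norm_eq_inner by (simp add: inner_diff inner_commute algebra_simps)
  then show ?thesis
    by (simp only:) (simp add: inner_diff_right distrib_left add_divide_distrib diff_divide_distrib)
qed

text \<open>
  Compare \<open>z\<close> with points of the segment from \<open>z\<close> to \<open>w\<close>: the increase of the objective at parameter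
  \<open>t\<close> is at most \<open>t (a + t b)\<close>, where \<open>a\<close> is the right-hand side of the claim. Divide by \<open>t\<close> and let
  \<open>t\<close> tend to 0.
\<close>

lemma prox_variational_inequality:
  fixes z w x g :: "'a::real_inner"
  assumes "convex S" and h: "convex_on S h"
    and z: "is_arg_min (\<lambda>z. h z + g \<bullet> z + 1 / (2 * \<alpha>) * (norm (z - x))\<^sup>2) (\<lambda>z. z \<in> S) z"
    and w: "w \<in> S"
  shows "0 \<le> h w - h z + g \<bullet> (w - z) + (z - x) \<bullet> (w - z) / \<alpha>"
proof -
  define a where "a = h w - h z + g \<bullet> (w - z) + (z - x) \<bullet> (w - z) / \<alpha>"
  define b where "b = 1 / (2 * \<alpha>) * (norm (w - z))\<^sup>2"
  have zS: "z \<in> S"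
    using z by (simp add: is_arg_min_def)
  have *: "0 \<le> a + t * b" if t: "0 < t" "t \<le> 1" for t
  proof -
    let ?y = "z + t *\<^sub>R (w - z)"
    have y: "?y = (1 - t) *\<^sub>R z + t *\<^sub>R w"
      by (simp add: algebra_simps)
    have "?y \<in> S"
      unfolding y using assms(1) zS w t by (intro convexD) auto
    then have "0 \<le> (h ?y + g \<bullet> ?y + 1 / (2 * \<alpha>) * (norm (?y - x))\<^sup>2)
                 - (h z + g \<bullet> z + 1 / (2 * \<alpha>) * (norm (z - x))\<^sup>2)"
      using z by (auto simp: is_arg_min_def not_less)
    also have "\<dots> = h ?y - h z + t * (g \<bullet> (w - z)) + t * ((z - x) \<bullet> (w - z) / \<alpha>) + t * (t * b)"
      unfolding prox_objective_diff b_def using t by (simp add: power2_eq_square)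
    also have "h ?y \<le> (1 - t) * h z + t * h w"
      unfolding y using h zS w t by (intro convex_onD) auto
    finally have "0 \<le> t * (a + t * b)"
      by (simp add: a_def algebra_simps)
    then show ?thesis
      using t by (simp add: zero_le_mult_iff)
  qed
  have "((\<lambda>t. a + t * b) \<longlongrightarrow> a + 0 * b) (at_right 0)"
    by (intro tendsto_intros)
  moreover have "\<forall>\<^sub>F t in at_right 0. 0 \<le> a + t * b"
    by (rule eventually_at_rightI[of 0 1]) (auto intro: *)
  ultimately show ?thesis
    unfolding a_def[symmetric] by (metis tendsto_lowerbound trivial_limit_at_right_real add_0_right mult_zero_left)
qed

text \<open>
  The quadratic term dominates the linear one and the lower bound of \<open>h\<close>, so a minimizer over a large ball
  around \<open>x\<close> is a global one. Uniqueness holds because the variational inequality leaves the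
  excess \<open>\<parallel>w - z\<parallel>\<^sup>2 / (2 \<alpha>)\<close> at any other point \<open>w\<close>.
\<close>

lemma prox_minimizer_unique:
  fixes x g :: "'a::euclidean_space"
  assumes S: "closed S" "convex S" and h: "convex_on UNIV h"
    and B: "\<And>z. z \<in> S \<Longrightarrow> B \<le> h z" and x: "x \<in> S" and \<alpha>: "0 < \<alpha>"
  shows "\<exists>!z. is_arg_min (\<lambda>z. h z + g \<bullet> z + 1 / (2 * \<alpha>) * (norm (z - x))\<^sup>2) (\<lambda>z. z \<in> S) z"
    (is "\<exists>!z. is_arg_min ?F _ z")
proof -
  have hS: "convex_on S h"
    using h by (rule convex_on_subset) (use S in auto)
  have cont: "continuous_on A h" for A
    using convex_on_continuous[OF open_UNIV h] continuous_on_subset by blast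
  \<comment> \<open>Beyond this radius \<open>r\<^sup>2 / (2 \<alpha>) \<ge> (\<parallel>g\<parallel> + (h x - B)) r\<close>; as \<open>r \<ge> 1\<close>, the objective exceeds its value at \<open>x\<close>.\<close>
  define R where "R = max 1 (2 * \<alpha> * (norm g + (h x - B)))"
  have "x \<in> S \<inter> cball x R"
    using x by (simp add: R_def)
  moreover have "compact (S \<inter> cball x R)"
    using S by (simp add: closed_Int_compact)
  moreover have "continuous_on (S \<inter> cball x R) ?F"
    by (intro continuous_intros cont)
  ultimately obtain z where z: "z \<in> S \<inter> cball x R" "\<And>y. y \<in> S \<inter> cball x R \<Longrightarrow> ?F z \<le> ?F y"
    using continuous_attains_inf[of "S \<inter> cball x R" ?F] by blast
  have "?F z \<le> ?F y" if y: "y \<in> S" for y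
  proof (cases "y \<in> cball x R")
    case True
    then show ?thesis using z y by blast
  next
    case False
    define r where "r = norm (y - x)"
    have r: "r > R" "r > 1" "r > 2 * \<alpha> * (norm g + (h x - B))"
      using False by (auto simp: r_def R_def dist_norm norm_minus_commute)
    have D: "0 \<le> h x - B" using B[OF x] by simp
    have "2 * \<alpha> * (norm g + (h x - B)) * r \<le> r * r"
      using r by (intro mult_right_mono) auto
    then have "(norm g + (h x - B)) * r \<le> 1 / (2 * \<alpha>) * r\<^sup>2"
      using \<alpha> by (simp add: field_simps power2_eq_square)
    moreover have "(h x - B) * 1 \<le> (h x - B) * r"
      using r D by (intro mult_left_mono) auto
    moreover have "- (norm g * r) \<le> g \<bullet> (y - x)"
      using Cauchy_Schwarz_ineq2[of g "y - x"] by (simp add: r_def abs_le_iff)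
    ultimately have "?F x \<le> ?F y"
      using B[OF y] by (simp add: inner_diff_right r_def algebra_simps)
    moreover have "?F z \<le> ?F x"
      using z \<open>x \<in> S \<inter> cball x R\<close> by blast
    ultimately show ?thesis by linarith
  qed
  then have min: "is_arg_min ?F (\<lambda>z. z \<in> S) z"
    using z by (auto simp: is_arg_min_linorder)
  moreover have "w = z" if w: "is_arg_min ?F (\<lambda>z. z \<in> S) w" for w
  proof -
    have "w \<in> S" "?F w \<le> ?F z"
      using w min by (auto simp: is_arg_min_linorder)
    then have "1 / (2 * \<alpha>) * (norm (w - z))\<^sup>2 \<le> 0"
      using prox_variational_inequality[OF S(2) hS min, of w] prox_objective_diff[of h w g \<alpha> x z]
      by linarith
    then show ?thesis
      using \<alpha> by (simp add: divide_le_0_iff)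
  qed
  ultimately show ?thesis by blast
qed

section \<open>Linear growth of coercive convex functions\<close>

text \<open>
  Coercivity gives a radius \<open>R\<close> around a base point \<open>a\<close> beyond which \<open>f \<ge> f a + 1\<close>. Along a ray from \<open>a\<close>,
  convexity then forces a slope of at least \<open>1 / R\<close>; on the ball of radius \<open>R\<close> the function is bounded below
  by compactness.
\<close>

lemma coercive_convex_linear_growth:
  fixes f :: "'a::euclidean_space \<Rightarrow> real"
  assumes S: "closed S" "convex S" "S \<noteq> {}" and f: "convex_on UNIV f" and co: "coercive_on S f"
  obtains c d where "0 < c" "\<And>x. x \<in> S \<Longrightarrow> c * norm x - d \<le> f x"
proof -
  obtain a where a: "a \<in> S" using S by blast
  have "\<forall>\<^sub>F x in at_infinity. x \<in> S \<longrightarrow> f a + 1 \<le> f x"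
    using co by (simp add: coercive_on_def filterlim_at_top eventually_inf_principal)
  then obtain b where b: "\<And>x. b \<le> norm x \<Longrightarrow> x \<in> S \<Longrightarrow> f a + 1 \<le> f x"
    by (auto simp: eventually_at_infinity)
  define R where "R = max 1 (b + norm a)"
  have R: "R \<ge> 1" by (simp add: R_def)
  have far: "f a + norm (x - a) / R \<le> f x" if x: "x \<in> S" "R \<le> norm (x - a)" for x
  proof -
    define t where "t = R / norm (x - a)"
    have t: "0 < t" "t \<le> 1" "t * norm (x - a) = R"
      using x R by (auto simp: t_def divide_simps)
    \<comment> \<open>The point of the segment from \<open>a\<close> to \<open>x\<close> at distance exactly \<open>R\<close> from \<open>a\<close>.\<close>
    let ?y = "(1 - t) *\<^sub>R a + t *\<^sub>R x"
    have "?y - a = t *\<^sub>R (x - a)" by (simp add: algebra_simps)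
    then have "norm (?y - a) = R" using t by simp
    then have "b \<le> norm ?y"
      using norm_triangle_ineq4[of ?y a] by (simp add: R_def)
    moreover have "?y \<in> S"
      using S(2) a x t by (intro convexD) auto
    ultimately have "f a + 1 \<le> f ?y" by (rule b)
    also have "\<dots> \<le> (1 - t) * f a + t * f x"
      using f t by (intro convex_onD) auto
    finally have "1 \<le> t * (f x - f a)" by (simp add: algebra_simps)
    then have "1 / t \<le> f x - f a" using t by (simp add: field_simps)
    moreover have "1 / t = norm (x - a) / R" by (simp add: t_def)
    ultimately show ?thesis by simp
  qed
  have "continuous_on (S \<inter> cball a R) f"
    using convex_on_continuous[OF open_UNIV f] continuous_on_subset by blast
  moreover have "compact (S \<inter> cball a R)" "S \<inter> cball a R \<noteq> {}"
    using S a R by (auto simp: closed_Int_compact)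
  ultimately obtain y where y: "\<And>x. x \<in> S \<inter> cball a R \<Longrightarrow> f y \<le> f x"
    using continuous_attains_inf[of "S \<inter> cball a R" f] by blast
  define d where "d = norm a / R + \<bar>f a\<bar> + \<bar>f y\<bar> + 1"
  have "1 / R * norm x - d \<le> f x" if x: "x \<in> S" for x
  proof -
    have n: "norm x / R \<le> norm (x - a) / R + norm a / R"
      using norm_triangle_ineq[of "x - a" a] R
      by (simp add: add_divide_distrib[symmetric] divide_right_mono)
    show ?thesis
    proof (cases "R \<le> norm (x - a)")
      case True
      then show ?thesis using far[OF x True] n by (simp add: d_def)
    next
      case False
      then have "norm (x - a) / R \<le> 1" "f y \<le> f x"
        using x y[of x] R by (auto simp: dist_norm norm_minus_commute)
      then show ?thesis using n by (simp add: d_def)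
    qed
  qed
  then show ?thesis
    using that[of "1 / R" d] R by auto
qed

section \<open>The ring penalty as a quadratic form\<close>

lemma gradient_eqI:
  assumes expand: "\<And>h. p (x + h) = p x + g \<bullet> h + q h"
    and q: "\<And>h. \<bar>q h\<bar> \<le> C * (norm h)\<^sup>2"
  shows "gradient p x = g"
proof -
  have "(\<lambda>h. norm (p (x + h) - p x - h \<bullet> g) / norm h) \<midarrow>0\<rightarrow> 0"
  proof (rule Lim_null_comparison)
    show "((\<lambda>h. C * norm h) \<longlongrightarrow> 0) (at 0)"
      by (auto intro!: tendsto_eq_intros)
    have "norm (norm (p (x + h) - p x - h \<bullet> g) / norm h) \<le> C * norm h" for h
      using q[of h] by (cases "h = 0") (auto simp: expand inner_commute divide_simps power2_eq_square mult.assoc)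
    then show "\<forall>\<^sub>F h in at 0. norm (norm (p (x + h) - p x - h \<bullet> g) / norm h) \<le> C * norm h"
      by simp
  qed
  then have g: "GDERIV p x :> g"
    unfolding gderiv_def has_derivative_at
    by (simp add: bounded_linear_inner_left)
  moreover have "g' = g" if "GDERIV p x :> g'" for g'
  proof -
    have "(\<lambda>h. h \<bullet> g') = (\<lambda>h. h \<bullet> g)"
      using that g unfolding gderiv_def by (rule has_derivative_unique)
    then have "(g' - g) \<bullet> (g' - g) = 0"
      by (metis inner_diff_right right_minus_eq)
    then show ?thesis by simp
  qed
  ultimately show ?thesis
    unfolding gradient_def by blast
qed

lemma norm_sq_vec: "(norm x)\<^sup>2 = (\<Sum>i\<in>UNIV. (norm (x $ i))\<^sup>2)"
  for x :: "'a::real_normed_vector^'m::finite"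
  by (simp add: norm_vec_def L2_set_def sum_nonneg)

lemma ring_penalty_nonneg: "0 < \<tau> \<Longrightarrow> 0 \<le> ring_penalty idx \<tau> x"
  by (simp add: ring_penalty_def sum_nonneg)

text \<open>
  Each block enters the differences around the ring exactly twice, and
  \<open>\<parallel>a - b\<parallel>\<^sup>2 \<le> 2 \<parallel>a\<parallel>\<^sup>2 + 2 \<parallel>b\<parallel>\<^sup>2\<close>; the sum of the squared differences is therefore at most \<open>4 \<parallel>x\<parallel>\<^sup>2\<close>.
\<close>

lemma ring_penalty_le:
  fixes x :: "real^'n::finite^'m::finite"
  assumes idx: "bij_betw idx {1..CARD('m)} (UNIV::'m set)" and \<tau>: "0 < \<tau>"
  shows "ring_penalty idx \<tau> x \<le> 2 / \<tau> * (norm x)\<^sup>2"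
proof -
  define m where "m = CARD('m) - 1"
  have m: "CARD('m) = Suc m" by (simp add: m_def)
  define N where "N k = (norm (x $ idx k))\<^sup>2" for k
  have sq: "(norm (a - b))\<^sup>2 \<le> 2 * (norm a)\<^sup>2 + 2 * (norm b)\<^sup>2" for a b :: "real^'n"
    using zero_le_power2[of "norm (a + b)"]
    unfolding power2_norm_eq_inner by (simp add: inner_simps inner_commute)
  have "(\<Sum>k = 1..m. (norm (x $ idx k - x $ idx (k + 1)))\<^sup>2) + (norm (x $ idx (Suc m) - x $ idx 1))\<^sup>2
        \<le> (\<Sum>k = 1..m. 2 * N k + 2 * N (k + 1)) + (2 * N (Suc m) + 2 * N 1)"
    unfolding N_def by (intro add_mono sum_mono sq)
  also have "\<dots> = 2 * (sum N {1..m} + N (Suc m)) + 2 * (N 1 + (\<Sum>k = 1..m. N (Suc k)))"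
    by (simp add: sum.distrib sum_distrib_left)
  also have "(\<Sum>k = 1..m. N (Suc k)) = sum N {2..Suc m}"
    using sum.shift_bounds_cl_Suc_ivl[of N 1 m] by (simp add: numeral_2_eq_2)
  also have "N 1 + sum N {2..Suc m} = sum N {1..Suc m}"
    by (simp add: sum.atLeast_Suc_atMost numeral_2_eq_2)
  also have "sum N {1..m} + N (Suc m) = sum N {1..Suc m}"
    by simp
  also have "sum N {1..Suc m} = (norm x)\<^sup>2"
    unfolding norm_sq_vec N_def m[symmetric] by (rule sum.reindex_bij_betw[OF idx])
  finally have "ring_penalty idx \<tau> x \<le> 1 / (2 * \<tau>) * (2 * (norm x)\<^sup>2 + 2 * (norm x)\<^sup>2)"
    unfolding ring_penalty_def m diff_Suc_1 using \<tau> by (intro mult_left_mono) auto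
  then show ?thesis
    by simp
qed

text \<open>
  The gradient at \<open>x\<close> represents the polar form \<open>B\<close> of the penalty with one argument fixed at \<open>x\<close>. There
  is no error term beyond the penalty of \<open>d\<close> itself, so both signs of the remainder are controlled.
\<close>

lemma ring_penalty_expand:
  fixes x d :: "real^'n::finite^'m::finite"
  assumes idx: "bij_betw idx {1..CARD('m)} (UNIV::'m set)" and \<tau>: "0 < \<tau>"
  shows "ring_penalty idx \<tau> (x + d)
    = ring_penalty idx \<tau> x + gradient (ring_penalty idx \<tau>) x \<bullet> d + ring_penalty idx \<tau> d"
proof -
  define B where "B y = 1 / \<tau> * ((\<Sum>k = 1..CARD('m) - 1. (x $ idx k - x $ idx (k + 1)) \<bullet> (y $ idx k - y $ idx (k + 1)))
       + (x $ idx CARD('m) - x $ idx 1) \<bullet> (y $ idx CARD('m) - y $ idx 1))" for y :: "real^'n^'m"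
  \<comment> \<open>For a linear functional \<open>B\<close>, \<open>adjoint B 1\<close> is its Riesz representative.\<close>
  have "linear B"
    unfolding B_def
    by (rule linearI)
       (simp_all add: inner_simps sum.distrib sum_subtractf sum_distrib_left algebra_simps)
  then have adj: "adjoint B 1 \<bullet> y = B y" for y
    using adjoint_works[of B y 1] by (simp add: inner_commute)
  have sq: "(norm ((a + a') - (b + b')))\<^sup>2 = (norm (a - b))\<^sup>2 + 2 * ((a - b) \<bullet> (a' - b')) + (norm (a' - b'))\<^sup>2"
    for a a' b b' :: "real^'n"
    unfolding power2_norm_eq_inner by (simp add: inner_simps inner_commute)
  have expand: "ring_penalty idx \<tau> (x + y) = ring_penalty idx \<tau> x + adjoint B 1 \<bullet> y + ring_penalty idx \<tau> y" for y
    unfolding adj unfolding ring_penalty_def B_def using \<tau>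
    by (simp add: sq sum.distrib sum_distrib_left[symmetric] field_simps)
  have "gradient (ring_penalty idx \<tau>) x = adjoint B 1"
    using expand
  proof (rule gradient_eqI)
    show "\<bar>ring_penalty idx \<tau> h\<bar> \<le> 2 / \<tau> * (norm h)\<^sup>2" for h :: "real^'n^'m"
      using ring_penalty_le[OF idx \<tau>, of h] ring_penalty_nonneg[OF \<tau>, of idx h] by linarith
  qed
  then show ?thesis
    using expand by simp
qed

section \<open>Separable functions on products of sets\<close>

lemma block_product_closed: "(\<And>i. closed (Xs i)) \<Longrightarrow> closed (block_product Xs)"
  unfolding block_product_def
  by (intro closed_Collect_all) (auto intro!: closed_vimage[unfolded vimage_def] continuous_intros)

lemma block_product_convex: "(\<And>i. convex (Xs i)) \<Longrightarrow> convex (block_product Xs)"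
  unfolding block_product_def by (auto simp: convex_def)

lemma convex_on_block_sum:
  assumes "\<And>i. convex_on UNIV (fs i)"
  shows "convex_on UNIV (block_sum fs)"
proof (rule convex_onI)
  fix t :: real and x y
  assume "0 < t" "t < 1"
  then have "fs i ((1 - t) *\<^sub>R x $ i + t *\<^sub>R y $ i) \<le> (1 - t) * fs i (x $ i) + t * fs i (y $ i)" for i
    using assms[of i] by (intro convex_onD) auto
  then show "block_sum fs ((1 - t) *\<^sub>R x + t *\<^sub>R y) \<le> (1 - t) * block_sum fs x + t * block_sum fs y"
    unfolding block_sum_def
    by (auto simp: sum_distrib_left sum.distrib[symmetric] intro!: sum_mono)
qed auto

text \<open>
  Varying a single block of the point \<open>w\<close> turns a lower bound of the sum into a lower bound of the
  corresponding summand. A weighted sum is then bounded below for all nonnegative weights.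
\<close>

lemma block_lower_bounds:
  assumes w: "w \<in> block_product Xs" and B: "\<And>x. x \<in> block_product Xs \<Longrightarrow> B \<le> block_sum fs x"
  shows "\<exists>b. \<forall>i. \<forall>v\<in>Xs i. b i \<le> fs i v"
proof -
  have "B - (\<Sum>j\<in>UNIV - {i}. fs j (w $ j)) \<le> fs i v" if v: "v \<in> Xs i" for i v
  proof -
    let ?x = "\<chi> j. if j = i then v else w $ j"
    have "?x \<in> block_product Xs"
      using w v by (simp add: block_product_def)
    then have "B \<le> (\<Sum>j\<in>UNIV. fs j (?x $ j))"
      using B unfolding block_sum_def by blast
    also have "\<dots> = fs i (?x $ i) + (\<Sum>j\<in>UNIV - {i}. fs j (?x $ j))"
      by (rule sum.remove) auto
    also have "(\<Sum>j\<in>UNIV - {i}. fs j (?x $ j)) = (\<Sum>j\<in>UNIV - {i}. fs j (w $ j))"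
      by (rule sum.cong) auto
    finally show ?thesis by simp
  qed
  then show ?thesis
    by (intro exI[of _ "\<lambda>i. B - (\<Sum>j\<in>UNIV - {i}. fs j (w $ j))"]) blast
qed

section \<open>One stage of the method\<close>

locale ring_prox =
  fixes Xs :: "'m::finite \<Rightarrow> (real^'n::finite) set" and fs :: "'m \<Rightarrow> real^'n \<Rightarrow> real"
    and b :: "'m \<Rightarrow> real" and idx :: "nat \<Rightarrow> 'm" and \<tau> \<alpha> :: real
  assumes idx: "bij_betw idx {1..CARD('m)} UNIV"
    and convex_Xs: "\<And>i. convex (Xs i)" and closed_Xs: "\<And>i. closed (Xs i)"
    and convex_fs: "\<And>i. convex_on UNIV (fs i)"
    and lower: "\<And>i v. v \<in> Xs i \<Longrightarrow> b i \<le> fs i v"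
    and \<tau>: "0 < \<tau>" and \<alpha>: "0 < \<alpha>"
begin

abbreviation "X \<equiv> block_product Xs"
abbreviation "p \<equiv> ring_penalty idx \<tau>"
abbreviation "wsum \<epsilon> \<equiv> block_sum (\<lambda>i v. \<epsilon> $ i * fs i v)"
abbreviation "step \<equiv> prox_step X fs p \<alpha>"
abbreviation "iter \<equiv> inner_iterate X fs p \<alpha>"

lemma convex_X: "convex X"
  by (rule block_product_convex) (rule convex_Xs)

lemma closed_X: "closed X"
  by (rule block_product_closed) (rule closed_Xs)

lemma tendsto_fs:
  assumes "(v \<longlongrightarrow> l) F"
  shows "((\<lambda>s. fs i (v s)) \<longlongrightarrow> fs i l) F"
  using convex_on_continuous[OF open_UNIV convex_fs[of i]] assms
  by (auto simp: continuous_on_eq_continuous_at intro: isCont_tendsto_compose)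

lemma convex_wsum:
  assumes "\<And>i. 0 \<le> \<epsilon> $ i"
  shows "convex_on UNIV (wsum \<epsilon>)"
  by (intro convex_on_block_sum convex_on_cmul assms convex_fs)

lemma wsum_lower:
  assumes "\<And>i. 0 \<le> \<epsilon> $ i" and "x \<in> X"
  shows "(\<Sum>i\<in>UNIV. \<epsilon> $ i * b i) \<le> wsum \<epsilon> x"
  unfolding block_sum_def
  using assms by (intro sum_mono mult_left_mono lower) (auto simp: block_product_def)

lemma step_is_arg_min:
  assumes "\<And>i. 0 \<le> \<epsilon> $ i" and "x \<in> X"
  shows "is_arg_min (\<lambda>z. wsum \<epsilon> z + gradient p x \<bullet> z + 1 / (2 * \<alpha>) * (norm (z - x))\<^sup>2)
           (\<lambda>z. z \<in> X) (step \<epsilon> x)"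
proof -
  have "\<exists>!z. is_arg_min (\<lambda>z. wsum \<epsilon> z + gradient p x \<bullet> z + 1 / (2 * \<alpha>) * (norm (z - x))\<^sup>2)
          (\<lambda>z. z \<in> X) z"
    using assms
    by (intro prox_minimizer_unique[OF closed_X convex_X convex_wsum wsum_lower _ \<alpha>]) auto
  from theI'[OF this] show ?thesis
    unfolding prox_step_def block_sum_def .
qed

lemma step_in_X: "(\<And>i. 0 \<le> \<epsilon> $ i) \<Longrightarrow> x \<in> X \<Longrightarrow> step \<epsilon> x \<in> X"
  using step_is_arg_min[of \<epsilon> x] by (simp add: is_arg_min_def)

text \<open>
  The variational inequality contains the slope of \<open>p\<close> at \<open>x\<close> in the direction \<open>w - z\<close>. Expanding \<open>p z\<close>
  and \<open>p w\<close> around the same point \<open>x\<close> shows that this slope is \<open>p w - p z + p (z - x) - p (w - x)\<close>; the last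
  term has the favourable sign and is dropped.
\<close>

lemma step_estimate:
  assumes \<epsilon>: "\<And>i. 0 \<le> \<epsilon> $ i" and x: "x \<in> X" and w: "w \<in> X"
  defines "z \<equiv> step \<epsilon> x"
  shows "wsum \<epsilon> z + p z \<le> wsum \<epsilon> w + p w + 2 / \<tau> * (norm (z - x))\<^sup>2 + (z - x) \<bullet> (w - z) / \<alpha>"
proof -
  have "convex_on X (wsum \<epsilon>)"
    using convex_wsum[OF \<epsilon>] by (rule convex_on_subset) (use convex_X in auto)
  from prox_variational_inequality[OF convex_X this step_is_arg_min[OF \<epsilon> x] w]
  have "0 \<le> wsum \<epsilon> w - wsum \<epsilon> z + gradient p x \<bullet> (w - z) + (z - x) \<bullet> (w - z) / \<alpha>"
    by (simp add: z_def)
  moreover have "p z = p x + gradient p x \<bullet> (z - x) + p (z - x)"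
    "p w = p x + gradient p x \<bullet> (w - x) + p (w - x)"
    using ring_penalty_expand[OF idx \<tau>, of x "z - x"] ring_penalty_expand[OF idx \<tau>, of x "w - x"]
    by simp_all
  moreover have "p (z - x) \<le> 2 / \<tau> * (norm (z - x))\<^sup>2"
    by (rule ring_penalty_le[OF idx \<tau>])
  moreover have "0 \<le> p (w - x)"
    by (rule ring_penalty_nonneg[OF \<tau>])
  ultimately show ?thesis
    by (simp add: inner_diff_right)
qed

lemma step_descent:
  assumes \<epsilon>: "\<And>i. 0 \<le> \<epsilon> $ i" and x: "x \<in> X" and \<beta>: "\<beta> + 2 / \<tau> \<le> 1 / \<alpha>"
  defines "z \<equiv> step \<epsilon> x"
  shows "wsum \<epsilon> z + p z \<le> wsum \<epsilon> x + p x - \<beta> * (norm (z - x))\<^sup>2"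
proof -
  have "(z - x) \<bullet> (x - z) / \<alpha> = - (1 / \<alpha> * (norm (z - x))\<^sup>2)"
    unfolding power2_norm_eq_inner by (simp add: inner_diff inner_commute diff_divide_distrib add_divide_distrib)
  moreover have "(\<beta> + 2 / \<tau>) * (norm (z - x))\<^sup>2 \<le> 1 / \<alpha> * (norm (z - x))\<^sup>2"
    using \<beta> by (intro mult_right_mono) auto
  ultimately show ?thesis
    using step_estimate[OF \<epsilon> x x] by (simp add: z_def distrib_right)
qed

lemma iter_Suc: "iter \<epsilon> x0 (Suc k) = step \<epsilon> (iter \<epsilon> x0 k)"
  by (simp add: inner_iterate_def)

lemma iter_in_X:
  assumes \<epsilon>: "\<And>i. 0 \<le> \<epsilon> $ i" and x0: "x0 \<in> X"
  shows "iter \<epsilon> x0 k \<in> X"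
proof (induction k)
  case 0
  then show ?case using x0 by (simp add: inner_iterate_def)
next
  case (Suc k)
  then show ?case using step_in_X[OF \<epsilon>] by (simp add: iter_Suc)
qed

text \<open>
  If the stopping test failed forever, each step would lower the penalized objective by at least
  \<open>\<beta> \<theta>\<^sup>2\<close>, against its lower bound on \<open>X\<close>.
\<close>

lemma stage_terminates:
  assumes \<epsilon>: "\<And>i. 0 \<le> \<epsilon> $ i" and x0: "x0 \<in> X"
    and \<beta>: "0 < \<beta>" "\<beta> + 2 / \<tau> \<le> 1 / \<alpha>" and \<theta>: "0 < \<theta>"
  shows "\<exists>k. stage_stops_at X fs p \<alpha> \<epsilon> \<theta> x0 k"
proof (rule ccontr)
  assume "\<not> ?thesis"
  then have far: "\<theta> < norm (iter \<epsilon> x0 (Suc k) - iter \<epsilon> x0 k)" for k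
    by (auto simp: stage_stops_at_def not_le)
  define \<phi> where "\<phi> k = wsum \<epsilon> (iter \<epsilon> x0 k) + p (iter \<epsilon> x0 k)" for k
  have "\<phi> k \<le> \<phi> 0 - k * (\<beta> * \<theta>\<^sup>2)" for k
  proof (induction k)
    case (Suc k)
    have "\<phi> (Suc k) \<le> \<phi> k - \<beta> * (norm (iter \<epsilon> x0 (Suc k) - iter \<epsilon> x0 k))\<^sup>2"
      unfolding \<phi>_def iter_Suc by (rule step_descent[OF \<epsilon> iter_in_X[OF \<epsilon> x0] \<beta>(2)])
    moreover have "\<beta> * \<theta>\<^sup>2 \<le> \<beta> * (norm (iter \<epsilon> x0 (Suc k) - iter \<epsilon> x0 k))\<^sup>2"
      using \<beta> \<theta> far[of k] by (intro mult_left_mono power_mono) auto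
    ultimately show ?case
      using Suc.IH by (simp add: distrib_right)
  qed simp
  moreover obtain k :: nat where "\<phi> 0 - (\<Sum>i\<in>UNIV. \<epsilon> $ i * b i) < k * (\<beta> * \<theta>\<^sup>2)"
    using reals_Archimedean3[of "\<beta> * \<theta>\<^sup>2"] \<beta> \<theta> by auto
  moreover have "(\<Sum>i\<in>UNIV. \<epsilon> $ i * b i) \<le> \<phi> k" for k
    unfolding \<phi>_def
    using wsum_lower[OF \<epsilon> iter_in_X[OF \<epsilon> x0]] ring_penalty_nonneg[OF \<tau>]
    by (meson add_increasing2)
  ultimately show False
    by (smt (verit))
qed

lemma stage_result_in_X:
  assumes \<epsilon>: "\<And>i. 0 \<le> \<epsilon> $ i" and x0: "x0 \<in> X"
    and v: "stage_result X fs p \<alpha> \<epsilon> \<theta> x0 v"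
  shows "v \<in> X"
  using v iter_in_X[OF \<epsilon> x0] unfolding stage_result_def by blast

lemma stage_result_near_optimal:
  assumes \<epsilon>: "\<And>i. 0 \<le> \<epsilon> $ i" and x0: "x0 \<in> X" and w: "w \<in> X"
    and v: "stage_result X fs p \<alpha> \<epsilon> \<theta> x0 v"
  shows "wsum \<epsilon> v + p v \<le> wsum \<epsilon> w + p w + 2 / \<tau> * \<theta>\<^sup>2 + \<theta> / \<alpha> * norm (v - w)"
proof -
  obtain k where k: "norm (iter \<epsilon> x0 (Suc k) - iter \<epsilon> x0 k) \<le> \<theta>" "v = iter \<epsilon> x0 (Suc k)"
    using v by (auto simp: stage_result_def stage_stops_at_def)
  define x where "x = iter \<epsilon> x0 k"
  have x: "x \<in> X" "v = step \<epsilon> x" "norm (v - x) \<le> \<theta>"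
    using k iter_in_X[OF \<epsilon> x0] by (auto simp: x_def iter_Suc)
  have "2 / \<tau> * (norm (v - x))\<^sup>2 \<le> 2 / \<tau> * \<theta>\<^sup>2"
    using x \<tau> by (intro mult_left_mono power_mono) auto
  moreover have "(v - x) \<bullet> (w - v) \<le> \<theta> * norm (v - w)"
    using norm_cauchy_schwarz[of "v - x" "w - v"] mult_right_mono[OF x(3), of "norm (v - w)"]
    by (simp add: norm_minus_commute)
  then have "(v - x) \<bullet> (w - v) / \<alpha> \<le> \<theta> / \<alpha> * norm (v - w)"
    using \<alpha> by (simp add: divide_right_mono)
  ultimately show ?thesis
    using step_estimate[OF \<epsilon> x(1) w] by (simp add: x(2))
qed

end

section \<open>Asymptotics of nearly optimal points for vanishing weights\<close>

text \<open>
  The last assumption is the property of stage results that matters for the limit; from here on it is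
  irrelevant by which algorithm the points \<open>u s\<close> were found.
\<close>

locale ring_prox_asymptotics = ring_prox Xs fs b idx \<tau> \<alpha>
  for Xs :: "'m::finite \<Rightarrow> (real^'n::finite) set" and fs :: "'m \<Rightarrow> real^'n \<Rightarrow> real"
    and b :: "'m \<Rightarrow> real" and idx :: "nat \<Rightarrow> 'm" and \<tau> \<alpha> :: real +
  fixes e :: "nat \<Rightarrow> real^'m" and \<theta> :: "nat \<Rightarrow> real" and u :: "nat \<Rightarrow> real^'n^'m"
  assumes e_pos: "\<And>s i. 1 \<le> s \<Longrightarrow> 0 < e s $ i"
    and e_lim: "\<And>i. (\<lambda>s. e s $ i) \<longlonglongrightarrow> 0"
    and e_ratio: "\<And>i j. i \<noteq> j \<Longrightarrow> (\<lambda>s. e s $ i / e s $ j) \<longlonglongrightarrow> 1"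
    and \<theta>_ratio: "\<And>j. (\<lambda>s. \<theta> s / e s $ j) \<longlonglongrightarrow> 0"
    and u_in_X: "\<And>s. u s \<in> X"
    and near_optimal: "\<And>s w. 1 \<le> s \<Longrightarrow> w \<in> X \<Longrightarrow>
      wsum (e s) (u s) + p (u s) \<le> wsum (e s) w + p w + 2 / \<tau> * (\<theta> s)\<^sup>2 + \<theta> s / \<alpha> * norm (u s - w)"
begin

lemma e_ratio_tendsto_1: "(\<lambda>s. e s $ i / e s $ j) \<longlonglongrightarrow> 1"
proof (cases "i = j")
  case True
  have "\<forall>\<^sub>F s in sequentially. 1 = e s $ i / e s $ j"
    using eventually_ge_at_top[of 1] by eventually_elim (use e_pos[of _ i] True in force)
  then show ?thesis
    by (rule Lim_transform_eventually[OF tendsto_const])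
qed (rule e_ratio)

lemma \<theta>_tendsto_0: "\<theta> \<longlonglongrightarrow> 0"
proof -
  fix j :: 'm
  have "(\<lambda>s. \<theta> s / e s $ j * e s $ j) \<longlonglongrightarrow> 0"
    using tendsto_mult[OF \<theta>_ratio[of j] e_lim[of j]] by (simp only: mult_zero_left)
  moreover have "\<forall>\<^sub>F s in sequentially. \<theta> s / e s $ j * e s $ j = \<theta> s"
    using eventually_ge_at_top[of 1] by eventually_elim (use e_pos[of _ j] in force)
  ultimately show ?thesis
    by (rule Lim_transform_eventually)
qed

text \<open>
  Once the penalty terms are cancelled, all remaining terms are at most of the order of the weights, and
  dividing by one of them leaves coefficients that converge.
\<close>

lemma near_optimal_scaled:
  assumes s: "1 \<le> s" and w: "w \<in> X" and le: "p w \<le> p (u s)"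
  shows "(\<Sum>i\<in>UNIV. e s $ i / e s $ j * fs i (u s $ i))
    \<le> (\<Sum>i\<in>UNIV. e s $ i / e s $ j * fs i (w $ i))
      + 2 / \<tau> * \<theta> s * (\<theta> s / e s $ j) + \<theta> s / e s $ j / \<alpha> * norm (u s - w)"
proof -
  have "wsum (e s) (u s) \<le> wsum (e s) w + 2 / \<tau> * (\<theta> s)\<^sup>2 + \<theta> s / \<alpha> * norm (u s - w)"
    using near_optimal[OF s w] le by linarith
  then have "wsum (e s) (u s) / e s $ j
      \<le> (wsum (e s) w + 2 / \<tau> * (\<theta> s)\<^sup>2 + \<theta> s / \<alpha> * norm (u s - w)) / e s $ j"
    using e_pos[OF s, of j] by (intro divide_right_mono) auto
  then show ?thesis
    by (simp add: block_sum_def sum_divide_distrib add_divide_distrib power2_eq_square mult_ac)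
qed

text \<open>
  Subtracting the lower bounds \<open>b i\<close> makes all summands nonnegative, so that, once every quotient of weights
  exceeds 1/2, the scaled sum at \<open>u s\<close> is at least half of the plain sum. The latter grows like
  \<open>c \<parallel>u s\<parallel>\<close>, whereas the error term has a slope in \<open>\<parallel>u s\<parallel>\<close> that tends to 0.
\<close>

lemma bounded_u:
  assumes co: "coercive_on X (block_sum fs)" and w: "w \<in> X" and min: "\<And>y. y \<in> X \<Longrightarrow> p w \<le> p y"
  shows "bounded (range u)"
proof -
  fix j :: 'm
  obtain c d where c: "0 < c" "\<And>x. x \<in> X \<Longrightarrow> c * norm x - d \<le> block_sum fs x"
    using coercive_convex_linear_growth[OF closed_X convex_X _ convex_on_block_sum[OF convex_fs] co] w
    by blast
  define r where "r i s = e s $ i / e s $ j" for i s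
  define \<delta> where "\<delta> s = \<theta> s / e s $ j" for s
  \<comment> \<open>Collects the terms of the estimate below that do not depend on \<open>u s\<close>; they converge, hence stay bounded.\<close>
  define A where "A s = (\<Sum>i\<in>UNIV. r i s * (fs i (w $ i) - b i)) + (d + sum b UNIV) / 2
      + 2 / \<tau> * \<theta> s * \<delta> s + \<bar>\<delta> s\<bar> / \<alpha> * norm w" for s
  have r: "r i \<longlonglongrightarrow> 1" for i
    unfolding r_def by (rule e_ratio_tendsto_1)
  have \<delta>: "\<delta> \<longlonglongrightarrow> 0"
    unfolding \<delta>_def by (rule \<theta>_ratio)
  have "A \<longlonglongrightarrow> (\<Sum>i\<in>UNIV. 1 * (fs i (w $ i) - b i)) + (d + sum b UNIV) / 2
      + 2 / \<tau> * 0 * 0 + \<bar>0\<bar> / \<alpha> * norm w"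
    unfolding A_def using \<alpha> by (intro tendsto_intros r \<delta> \<theta>_tendsto_0) auto
  then have "Bseq A"
    by (intro convergent_imp_Bseq convergentI)
  then obtain K where K: "\<And>s. \<bar>A s\<bar> \<le> K"
    by (auto simp: Bseq_def)
  have "\<forall>\<^sub>F s in sequentially. \<forall>i. 1 / 2 < r i s"
    by (intro eventually_all_finite order_tendstoD(1)[OF r]) simp
  moreover have "\<forall>\<^sub>F s in sequentially. \<bar>\<delta> s\<bar> < \<alpha> * c / 4"
    using tendsto_rabs[OF \<delta>] \<alpha> c by (intro order_tendstoD(2)) auto
  ultimately have "\<forall>\<^sub>F s in sequentially. norm (u s) \<le> 4 * K / c"
    using eventually_ge_at_top[of 1]
  proof eventually_elim
    case (elim s)
    let ?z = "u s"
    have lowz: "b i \<le> fs i (?z $ i)" for i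
      using u_in_X[of s] lower by (auto simp: block_product_def)
    have "1 / 2 * (fs i (?z $ i) - b i) \<le> r i s * (fs i (?z $ i) - b i)" for i
      using elim(1) lowz by (intro mult_right_mono) (auto simp: less_imp_le)
    then have "(\<Sum>i\<in>UNIV. 1 / 2 * (fs i (?z $ i) - b i)) \<le> (\<Sum>i\<in>UNIV. r i s * (fs i (?z $ i) - b i))"
      by (intro sum_mono)
    also have "(\<Sum>i\<in>UNIV. 1 / 2 * (fs i (?z $ i) - b i)) = (block_sum fs ?z - sum b UNIV) / 2"
      by (simp add: block_sum_def sum_distrib_left[symmetric] sum_divide_distrib[symmetric] sum_subtractf)
    finally have "(c * norm ?z - d - sum b UNIV) / 2 \<le> (\<Sum>i\<in>UNIV. r i s * (fs i (?z $ i) - b i))"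
      using c(2)[OF u_in_X[of s]] by simp
    also have "\<dots> \<le> (\<Sum>i\<in>UNIV. r i s * (fs i (w $ i) - b i)) + 2 / \<tau> * \<theta> s * \<delta> s + \<delta> s / \<alpha> * norm (?z - w)"
      using near_optimal_scaled[OF elim(3) w min[OF u_in_X], of j]
      by (simp add: r_def \<delta>_def right_diff_distrib sum_subtractf)
    also have "\<delta> s / \<alpha> * norm (?z - w) \<le> \<bar>\<delta> s\<bar> / \<alpha> * (norm ?z + norm w)"
      using \<alpha> norm_triangle_ineq4[of ?z w] by (intro mult_mono divide_right_mono) auto
    also have "(c * norm ?z - d - sum b UNIV) / 2 = c / 2 * norm ?z - (d + sum b UNIV) / 2"
      by (simp add: diff_divide_distrib add_divide_distrib)
    finally have "c / 2 * norm ?z \<le> A s + \<bar>\<delta> s\<bar> / \<alpha> * norm ?z"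
      unfolding A_def distrib_left by linarith
    also have "\<bar>\<delta> s\<bar> / \<alpha> * norm ?z \<le> c / 4 * norm ?z"
      using elim(2) \<alpha> by (intro mult_right_mono) (auto simp: field_simps)
    finally have "c / 4 * norm ?z \<le> K"
      using K[of s] by linarith
    then show ?case
      using c by (simp add: field_simps)
  qed
  then have "Bseq u"
    by (rule BfunI)
  then show ?thesis
    by (simp add: Bseq_eq_bounded)
qed

context
  fixes r l
  assumes r: "strict_mono r" and l: "(u \<circ> r) \<longlonglongrightarrow> l"
begin

lemma limit_in_X: "l \<in> X"
  using closed_X l u_in_X by (metis (no_types, lifting) closed_sequentially comp_apply)

lemma along: "g \<longlonglongrightarrow> a \<Longrightarrow> (\<lambda>k. g (r k)) \<longlonglongrightarrow> a"
  using LIMSEQ_subseq_LIMSEQ[OF _ r] by (simp add: comp_def)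

lemma u_along: "(\<lambda>k. u (r k)) \<longlonglongrightarrow> l"
  using l by (simp add: comp_def)

lemma eventually_stage: "\<forall>\<^sub>F k in sequentially. 1 \<le> r k"
  using filterlim_subseq[OF r] by (simp add: filterlim_at_top)

lemma limit_minimizes_penalty:
  assumes w: "w \<in> X"
  shows "p l \<le> p w"
proof -
  have "(\<lambda>k. (\<Sum>i\<in>UNIV. e (r k) $ i * fs i (u (r k) $ i)) + p (u (r k)))
      \<longlonglongrightarrow> (\<Sum>i\<in>UNIV. 0 * fs i (l $ i)) + p l"
    unfolding ring_penalty_def
    by (intro tendsto_intros along[OF e_lim] tendsto_fs u_along)
  moreover have "(\<lambda>k. (\<Sum>i\<in>UNIV. e (r k) $ i * fs i (w $ i)) + p w + 2 / \<tau> * (\<theta> (r k))\<^sup>2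
        + \<theta> (r k) / \<alpha> * norm (u (r k) - w))
      \<longlonglongrightarrow> (\<Sum>i\<in>UNIV. 0 * fs i (w $ i)) + p w + 2 / \<tau> * 0\<^sup>2 + 0 / \<alpha> * norm (l - w)"
    using \<alpha> by (intro tendsto_intros along[OF e_lim] along[OF \<theta>_tendsto_0] u_along) auto
  moreover have "\<forall>\<^sub>F k in sequentially.
      (\<Sum>i\<in>UNIV. e (r k) $ i * fs i (u (r k) $ i)) + p (u (r k))
      \<le> (\<Sum>i\<in>UNIV. e (r k) $ i * fs i (w $ i)) + p w + 2 / \<tau> * (\<theta> (r k))\<^sup>2
        + \<theta> (r k) / \<alpha> * norm (u (r k) - w)"
    using eventually_stage
    by eventually_elim (use near_optimal[OF _ w] in \<open>simp add: block_sum_def\<close>)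
  ultimately have "(\<Sum>i\<in>UNIV. 0 * fs i (l $ i)) + p l
      \<le> (\<Sum>i\<in>UNIV. 0 * fs i (w $ i)) + p w + 2 / \<tau> * 0\<^sup>2 + 0 / \<alpha> * norm (l - w)"
    using tendsto_le[OF sequentially_bot] by blast
  then show ?thesis by simp
qed

lemma limit_minimizes_sum:
  assumes w: "w \<in> X" and min: "\<And>y. y \<in> X \<Longrightarrow> p w \<le> p y"
  shows "block_sum fs l \<le> block_sum fs w"
proof -
  fix j :: 'm
  have "(\<lambda>k. \<Sum>i\<in>UNIV. e (r k) $ i / e (r k) $ j * fs i (u (r k) $ i))
      \<longlonglongrightarrow> (\<Sum>i\<in>UNIV. 1 * fs i (l $ i))"
    by (intro tendsto_intros along[OF e_ratio_tendsto_1] tendsto_fs u_along)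
  moreover have "(\<lambda>k. (\<Sum>i\<in>UNIV. e (r k) $ i / e (r k) $ j * fs i (w $ i))
        + 2 / \<tau> * \<theta> (r k) * (\<theta> (r k) / e (r k) $ j) + \<theta> (r k) / e (r k) $ j / \<alpha> * norm (u (r k) - w))
      \<longlonglongrightarrow> (\<Sum>i\<in>UNIV. 1 * fs i (w $ i)) + 2 / \<tau> * 0 * 0 + 0 / \<alpha> * norm (l - w)"
    using \<alpha> by (intro tendsto_add tendsto_mult tendsto_divide tendsto_sum tendsto_const tendsto_norm
        tendsto_diff along[OF e_ratio_tendsto_1] along[OF \<theta>_ratio] along[OF \<theta>_tendsto_0] u_along) auto
  moreover have "\<forall>\<^sub>F k in sequentially.
      (\<Sum>i\<in>UNIV. e (r k) $ i / e (r k) $ j * fs i (u (r k) $ i))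
      \<le> (\<Sum>i\<in>UNIV. e (r k) $ i / e (r k) $ j * fs i (w $ i))
        + 2 / \<tau> * \<theta> (r k) * (\<theta> (r k) / e (r k) $ j) + \<theta> (r k) / e (r k) $ j / \<alpha> * norm (u (r k) - w)"
    using eventually_stage
    by eventually_elim (rule near_optimal_scaled[OF _ w min[OF u_in_X]])
  ultimately have "(\<Sum>i\<in>UNIV. 1 * fs i (l $ i))
      \<le> (\<Sum>i\<in>UNIV. 1 * fs i (w $ i)) + 2 / \<tau> * 0 * 0 + 0 / \<alpha> * norm (l - w)"
    using tendsto_le[OF sequentially_bot] by blast
  then show ?thesis by (simp add: block_sum_def)
qed

end

end

section \<open>Convergence of the method\<close>

text \<open>
  The infimum in the definition of \<open>minimizers\<close> is taken in the conditionally complete order of the reals,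
  hence the boundedness hypothesis.
\<close>

lemma minimizers_iff:
  fixes p :: "'a \<Rightarrow> real"
  assumes "bdd_below (p ` X)"
  shows "x \<in> minimizers X p \<longleftrightarrow> x \<in> X \<and> (\<forall>y\<in>X. p x \<le> p y)"
proof
  assume "x \<in> minimizers X p"
  then show "x \<in> X \<and> (\<forall>y\<in>X. p x \<le> p y)"
    using cINF_lower[OF assms] by (auto simp: minimizers_def)
next
  assume "x \<in> X \<and> (\<forall>y\<in>X. p x \<le> p y)"
  then show "x \<in> minimizers X p"
    using cINF_lower[OF assms] by (auto simp: minimizers_def intro!: antisym cINF_greatest)
qed

theorem theorem2:
  fixes Xs :: "'m::finite \<Rightarrow> (real^'n::finite) set"
    and fs :: "'m \<Rightarrow> real^'n \<Rightarrow> real"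
    and X :: "(real^'n^'m) set"
    and f p :: "real^'n^'m \<Rightarrow> real"
    and idx :: "nat \<Rightarrow> 'm"
    and \<alpha> \<beta> \<tau> :: real
    and e :: "nat \<Rightarrow> real^'m"
    and \<theta> :: "nat \<Rightarrow> real"
    and u0 :: "real^'n^'m"
  assumes idx: "bij_betw idx {1..CARD('m)} UNIV"
    and Xs: "\<And>i. convex (Xs i)" "\<And>i. closed (Xs i)"
    and fs: "\<And>i. convex_on UNIV (fs i)"
    and X: "X = block_product Xs"
    and f: "f = block_sum fs"
    and p: "p = ring_penalty idx \<tau>"
    and minimizers_nonempty: "minimizers X p \<noteq> {}"
    and coercive: "coercive_on X f"
    and beta: "0 < \<beta>" "\<beta> < 1"
    and tau: "1 \<le> \<tau>"
    and alpha: "0 < \<alpha>" "\<alpha> \<le> 1 / (\<beta> + 2 / \<tau>)"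
    and e_pos: "\<And>s i. 1 \<le> s \<Longrightarrow> 0 < e s $ i"
    and e_nonincreasing: "\<And>s i. 1 \<le> s \<Longrightarrow> e (s + 1) $ i \<le> e s $ i"
    and e_lim: "\<And>i. (\<lambda>s. e s $ i) \<longlonglongrightarrow> 0"
    and e_ratio: "\<And>i j. i \<noteq> j \<Longrightarrow> (\<lambda>s. e s $ i / e s $ j) \<longlonglongrightarrow> 1"
    and theta_pos: "\<And>s. 1 \<le> s \<Longrightarrow> 0 < \<theta> s"
    and theta_ratio: "\<And>j. (\<lambda>s. \<theta> s / e s $ j) \<longlonglongrightarrow> 0"
    and u0: "u0 \<in> X"
  shows "(\<forall>s\<ge>1. \<forall>u. dpm_run_upto X fs p \<alpha> e \<theta> u0 (s - 1) u \<longrightarrow>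
            (\<exists>k. stage_stops_at X fs p \<alpha> (e s) (\<theta> s) (u (s - 1)) k))
       \<and> (\<forall>u. dpm_run X fs p \<alpha> e \<theta> u0 u \<longrightarrow>
            (\<exists>l. limit_point_of_seq u l) \<and>
            (\<forall>l. limit_point_of_seq u l \<longrightarrow> is_arg_min f (\<lambda>x. x \<in> minimizers X p) l))"
proof -
  have \<tau>: "0 < \<tau>"
    using tau by simp
  have \<beta>: "\<beta> + 2 / \<tau> \<le> 1 / \<alpha>"
  proof -
    have "0 < \<beta> + 2 / \<tau>"
      using beta \<tau> by (simp add: add_pos_pos)
    then show ?thesis
      using alpha by (simp add: field_simps)
  qed
  obtain w where "w \<in> minimizers X p"
    using minimizers_nonempty by blast
  moreover have minimizers_iff: "x \<in> minimizers X p \<longleftrightarrow> x \<in> X \<and> (\<forall>y\<in>X. p x \<le> p y)" for x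
    unfolding p using ring_penalty_nonneg[OF \<tau>] by (intro minimizers_iff bdd_belowI) auto
  ultimately have w: "w \<in> X" "\<And>y. y \<in> X \<Longrightarrow> p w \<le> p y"
    by auto
  have X_props: "closed X" "convex X" "X \<noteq> {}" "convex_on UNIV f" "coercive_on X f"
    unfolding X f using w(1) coercive Xs fs
    by (auto simp: X f intro: block_product_closed block_product_convex convex_on_block_sum)
  obtain c d where "0 < c" and growth: "\<And>x. x \<in> X \<Longrightarrow> c * norm x - d \<le> f x"
    using coercive_convex_linear_growth[OF X_props] by blast
  have f_lower: "- d \<le> f x" if "x \<in> X" for x
  proof -
    have "0 \<le> c * norm x"
      using \<open>0 < c\<close> by simp
    then show ?thesis
      using growth[OF that] by linarith
  qed
  obtain b where b: "\<forall>i. \<forall>v\<in>Xs i. b i \<le> fs i v"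
    using block_lower_bounds[OF w(1)[unfolded X] f_lower[unfolded X f]] by fast
  interpret ring_prox Xs fs b idx \<tau> \<alpha>
  proof
    show "bij_betw idx {1..CARD('m)} UNIV" "0 < \<tau>" "0 < \<alpha>"
      by (fact idx \<tau> alpha(1))+
    show "convex (Xs i)" "closed (Xs i)" "convex_on UNIV (fs i)" for i
      by (fact Xs fs)+
    show "b i \<le> fs i v" if "v \<in> Xs i" for i v
      using b that by blast
  qed
  have e: "0 \<le> e s $ i" if "1 \<le> s" for s i
    using e_pos[OF that] by (rule less_imp_le)
  have run_in_X: "u s \<in> X" if "dpm_run_upto X fs p \<alpha> e \<theta> u0 S u" "s \<le> S" for u s S
    using that(2)
  proof (induction s)
    case 0
    then show ?case using that u0 by (simp add: dpm_run_upto_def)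
  next
    case (Suc s)
    then have "stage_result X fs p \<alpha> (e (Suc s)) (\<theta> (Suc s)) (u s) (u (Suc s))"
      using that by (force simp: dpm_run_upto_def)
    moreover have "u s \<in> X"
      using Suc by simp
    ultimately show ?case
      using stage_result_in_X[folded X p, of "e (Suc s)"] e[of "Suc s"] by auto
  qed
  show ?thesis
  proof (intro conjI allI impI)
    fix s u
    assume s: "1 \<le> s" and "dpm_run_upto X fs p \<alpha> e \<theta> u0 (s - 1) u"
    then have "u (s - 1) \<in> X"
      using run_in_X by blast
    then show "\<exists>k. stage_stops_at X fs p \<alpha> (e s) (\<theta> s) (u (s - 1)) k"
      by (rule stage_terminates[folded X p, OF e[OF s] _ beta(1) \<beta> theta_pos[OF s]])
  next
    fix u
    assume run: "dpm_run X fs p \<alpha> e \<theta> u0 u"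
    then have u_in_X: "u s \<in> X" for s
      unfolding dpm_run_def using run_in_X by blast
    have stage: "stage_result X fs p \<alpha> (e s) (\<theta> s) (u (s - 1)) (u s)" if "1 \<le> s" for s
    proof -
      have "dpm_run_upto X fs p \<alpha> e \<theta> u0 s u"
        using run by (simp add: dpm_run_def)
      then show ?thesis
        using that by (simp add: dpm_run_upto_def)
    qed
    interpret ring_prox_asymptotics Xs fs b idx \<tau> \<alpha> e \<theta> u
    proof unfold_locales
      show "0 < e s $ i" if "1 \<le> s" for s i
        using that by (rule e_pos)
      show "(\<lambda>s. e s $ i) \<longlonglongrightarrow> 0" "(\<lambda>s. \<theta> s / e s $ i) \<longlonglongrightarrow> 0" for i
        by (fact e_lim theta_ratio)+
      show "(\<lambda>s. e s $ i / e s $ j) \<longlonglongrightarrow> 1" if "i \<noteq> j" for i j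
        using that by (rule e_ratio)
      show "u s \<in> block_product Xs" for s
        using u_in_X unfolding X .
      show "wsum (e s) (u s) + ring_penalty idx \<tau> (u s)
        \<le> wsum (e s) w + ring_penalty idx \<tau> w + 2 / \<tau> * (\<theta> s)\<^sup>2 + \<theta> s / \<alpha> * norm (u s - w)"
        if "1 \<le> s" "w \<in> block_product Xs" for s w
        by (rule stage_result_near_optimal[OF e[OF that(1)] u_in_X[unfolded X] that(2)
              stage[OF that(1), unfolded X p]])
    qed
    have "bounded (range u)"
      using bounded_u[folded X f p, OF coercive w] .
    then show "\<exists>l. limit_point_of_seq u l"
      using bounded_imp_convergent_subsequence[of u] unfolding limit_point_of_seq_def by blast
    fix l
    assume "limit_point_of_seq u l"
    then obtain r where r: "strict_mono r" "(u \<circ> r) \<longlonglongrightarrow> l"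
      by (auto simp: limit_point_of_seq_def)
    have "l \<in> minimizers X p"
      unfolding minimizers_iff
      using limit_in_X[folded X, OF r] limit_minimizes_penalty[folded X p, OF r] by simp
    moreover have "f l \<le> f y" if "y \<in> minimizers X p" for y
      using that limit_minimizes_sum[folded X f p, OF r, of y] by (simp add: minimizers_iff)
    ultimately show "is_arg_min f (\<lambda>x. x \<in> minimizers X p) l"
      by (simp add: is_arg_min_linorder)
  qed
qed

end
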